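(* Let $0<\alpha,\beta\le 1$ and consider the three-player minimax optimization problem $\min_{G}\max_{D_1,D_2}\mathcal{J}(G,D_1,D_2)$, where $$\mathcal{J}(G,D_1,D_2)=\alpha\,\mathbb{E}_{x\sim P_{\mathrm{data}}}[\log D_1(x)]+\mathbb{E}_{z\sim P_z}[-D_1(G(z))]+\mathbb{E}_{x\sim P_{\mathrm{data}}}[-D_2(x)]+\beta\,\mathbb{E}_{z\sim P_z}[\log D_2(G(z))].$$ Given the optimal discriminators $D_1^\star,D_2^\star$ (defined in the context), at the Nash equilibrium point $(G^\star,D_1^\star,D_2^\star)$ of this minimax optimization problem, each component has the following form: $$\mathcal{J}(G^\star,D_1^\star,D_2^\star)=\alpha(\log\alpha-1)+\beta(\log\beta-1),$$ $$D_1^\star(x)=\alpha\ \text{ and }\ D_2^\star(x)=\beta,\ \forall x,\quad\text{at } p_{G^\star}=p_{\mathrm{data}}.$$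
   Context: $P_{\mathrm{data}}$ is the data distribution on the data space, with probability density function $p_{\mathrm{data}}$. The noise vector $z$ is drawn from a prior distribution $P_z$ on a noise space. A generator $G$ maps the noise space to the data space; the mapping $G(z)$ induces the generator distribution $P_G$ on the data space, with probability density function $p_G$. The discriminators $D_1,D_2$ are functions on the data space with values in $\mathbb{R}^+$ (positive and unbounded scores, not probabilities). $G$, $D_1$ and $D_2$ are assumed to have enough capacity (the nonparametric limit). For a fixed generator $G$, the optimal discriminators, i.e. those obtained by maximizing $\mathcal{J}(G,D_1,D_2)$ over $D_1,D_2$, are $D_1^\star(x)=\alpha\,p_{\mathrm{data}}(x)/p_G(x)$ and $D_2^\star(x)=\beta\,p_G(x)/p_{\mathrm{data}}(x)$; $G^\star$ denotes the optimal solution for the generator when the discriminators are fixed to $D_1=D_1^\star$, $D_2=D_2^\star$. *)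

theory Defs
  imports "HOL-Probability.Probability"
begin

text \<open>
  The data space is the measure space \<open>M\<close> with respect to which densities are taken, the noise
  space with its prior is the probability space \<open>N\<close>. All densities are real-valued functions on
  the data space.
\<close>

definition prob_density :: "'x measure \<Rightarrow> ('x \<Rightarrow> real) \<Rightarrow> bool" where
  "prob_density M p \<longleftrightarrow>
     p \<in> borel_measurable M \<and> (\<forall>x\<in>space M. 0 \<le> p x) \<and> prob_space (density M (\<lambda>x. ennreal (p x)))"

definition induces_density :: "'z measure \<Rightarrow> 'x measure \<Rightarrow> ('z \<Rightarrow> 'x) \<Rightarrow> ('x \<Rightarrow> real) \<Rightarrow> bool" where
  "induces_density N M G p \<longleftrightarrow> prob_density M p \<and> distributed N M G (\<lambda>x. ennreal (p x))"

definition generator :: "'z measure \<Rightarrow> 'x measure \<Rightarrow> ('z \<Rightarrow> 'x) \<Rightarrow> bool" where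
  "generator N M G \<longleftrightarrow> (\<exists>p. induces_density N M G p)"

text \<open>
  The nonparametric limit for the generator: every density on the data space is the density of some
  generator distribution. For the discriminators it is built in, as all
  strictly positive measurable functions are allowed.
\<close>

definition enough_capacity :: "'z measure \<Rightarrow> 'x measure \<Rightarrow> bool" where
  "enough_capacity N M \<longleftrightarrow> (\<forall>p. prob_density M p \<longrightarrow> (\<exists>G. induces_density N M G p))"

definition discriminator :: "'x measure \<Rightarrow> ('x \<Rightarrow> real) \<Rightarrow> bool" where
  "discriminator M D \<longleftrightarrow> D \<in> borel_measurable M \<and> (\<forall>x\<in>space M. 0 < D x)"

definition objective ::
  "real \<Rightarrow> real \<Rightarrow> 'z measure \<Rightarrow> 'x measure \<Rightarrow> ('x \<Rightarrow> real) \<Rightarrow>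
   ('z \<Rightarrow> 'x) \<Rightarrow> ('x \<Rightarrow> real) \<Rightarrow> ('x \<Rightarrow> real) \<Rightarrow> real" where
  "objective \<alpha> \<beta> N M p_data G D1 D2 =
     \<alpha> * (\<integral>x. ln (D1 x) \<partial>(density M (\<lambda>x. ennreal (p_data x))))
     + (\<integral>z. - D1 (G z) \<partial>N)
     + (\<integral>x. - D2 x \<partial>(density M (\<lambda>x. ennreal (p_data x))))
     + \<beta> * (\<integral>z. ln (D2 (G z)) \<partial>N)"

text \<open>
  The Bochner integral of a non-integrable function is 0, so the objective has its intended meaning
  only if the four expectations exist. Without this restriction a discriminator with
  infinite loss could be given a spurious finite payoff.
\<close>

definition admissible ::
  "'z measure \<Rightarrow> 'x measure \<Rightarrow> ('x \<Rightarrow> real) \<Rightarrow>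
   ('z \<Rightarrow> 'x) \<Rightarrow> ('x \<Rightarrow> real) \<Rightarrow> ('x \<Rightarrow> real) \<Rightarrow> bool" where
  "admissible N M p_data G D1 D2 \<longleftrightarrow>
     generator N M G \<and> discriminator M D1 \<and> discriminator M D2
     \<and> integrable (density M (\<lambda>x. ennreal (p_data x))) (\<lambda>x. ln (D1 x))
     \<and> integrable N (\<lambda>z. D1 (G z))
     \<and> integrable (density M (\<lambda>x. ennreal (p_data x))) D2
     \<and> integrable N (\<lambda>z. ln (D2 (G z)))"

text \<open>
  The inner maximum is taken in the extended reals: it is \<open>\<infinity>\<close> for generators
  with an infinite Kullback-Leibler divergence from or to the data distribution.
\<close>

definition inner_max ::
  "real \<Rightarrow> real \<Rightarrow> 'z measure \<Rightarrow> 'x measure \<Rightarrow> ('x \<Rightarrow> real) \<Rightarrow> ('z \<Rightarrow> 'x) \<Rightarrow> ereal" where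
  "inner_max \<alpha> \<beta> N M p_data G =
     (SUP (D1, D2) \<in> {(D1, D2). admissible N M p_data G D1 D2}.
        ereal (objective \<alpha> \<beta> N M p_data G D1 D2))"

definition minimax_solution ::
  "real \<Rightarrow> real \<Rightarrow> 'z measure \<Rightarrow> 'x measure \<Rightarrow> ('x \<Rightarrow> real) \<Rightarrow>
   ('z \<Rightarrow> 'x) \<Rightarrow> ('x \<Rightarrow> real) \<Rightarrow> ('x \<Rightarrow> real) \<Rightarrow> bool" where
  "minimax_solution \<alpha> \<beta> N M p_data G D1 D2 \<longleftrightarrow>
     admissible N M p_data G D1 D2
     \<and> ereal (objective \<alpha> \<beta> N M p_data G D1 D2) = inner_max \<alpha> \<beta> N M p_data G
     \<and> (\<forall>G'. generator N M G' \<longrightarrow> inner_max \<alpha> \<beta> N M p_data G \<le> inner_max \<alpha> \<beta> N M p_data G')"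

text \<open>Equilibrium of the three-player game: no player gains by a unilateral deviation.\<close>

definition nash_equilibrium ::
  "real \<Rightarrow> real \<Rightarrow> 'z measure \<Rightarrow> 'x measure \<Rightarrow> ('x \<Rightarrow> real) \<Rightarrow>
   ('z \<Rightarrow> 'x) \<Rightarrow> ('x \<Rightarrow> real) \<Rightarrow> ('x \<Rightarrow> real) \<Rightarrow> bool" where
  "nash_equilibrium \<alpha> \<beta> N M p_data G D1 D2 \<longleftrightarrow>
     admissible N M p_data G D1 D2
     \<and> (\<forall>D1'. admissible N M p_data G D1' D2 \<longrightarrow>
          objective \<alpha> \<beta> N M p_data G D1' D2 \<le> objective \<alpha> \<beta> N M p_data G D1 D2)
     \<and> (\<forall>D2'. admissible N M p_data G D1 D2' \<longrightarrow>
          objective \<alpha> \<beta> N M p_data G D1 D2' \<le> objective \<alpha> \<beta> N M p_data G D1 D2)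
     \<and> (\<forall>G'. admissible N M p_data G' D1 D2 \<longrightarrow>
          objective \<alpha> \<beta> N M p_data G D1 D2 \<le> objective \<alpha> \<beta> N M p_data G' D1 D2)"

text \<open>
  The optimal discriminators against a generator with density \<open>p_G\<close>. Since \<open>a / 0 = 0\<close>, they are
  strictly positive, hence discriminators, only when both densities are
  strictly positive on the data space.
\<close>

definition opt_D1 :: "real \<Rightarrow> ('x \<Rightarrow> real) \<Rightarrow> ('x \<Rightarrow> real) \<Rightarrow> 'x \<Rightarrow> real" where
  "opt_D1 \<alpha> p_data p_G x = \<alpha> * p_data x / p_G x"

definition opt_D2 :: "real \<Rightarrow> ('x \<Rightarrow> real) \<Rightarrow> ('x \<Rightarrow> real) \<Rightarrow> 'x \<Rightarrow> real" where
  "opt_D2 \<beta> p_data p_G x = \<beta> * p_G x / p_data x"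

end

theory Submission
  imports Defs
begin

text \<open>
  Pointwise, \<open>a ln t - t \<le> a (ln a - 1)\<close> with equality at \<open>t = a\<close>. Hence against the data density
  no discriminators pay more than \<open>v = \<alpha> (ln \<alpha> - 1) + \<beta> (ln \<beta> - 1)\<close>, while the constant
  discriminators \<open>\<alpha>, \<beta>\<close> pay exactly \<open>v\<close> against every generator. The optimal discriminators
  against the density \<open>q\<close> pay \<open>v + \<alpha> KL(p | q) + \<beta> KL(q | p)\<close>, so at a minimax solution both
  divergences vanish. At a Nash equilibrium, comparing \<open>q\<close> with \<open>q\<close> conditioned on the event
  \<open>q < p\<close> shows that this event has probability 0 or 1, which forces \<open>p = q\<close> almost everywhere.
\<close>

section \<open>Pointwise inequalities for the logarithm\<close>

lemma payoff_le:
  fixes a t :: real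
  assumes "0 < a" "0 < t"
  shows "a * ln t - t \<le> a * (ln a - 1)"
proof -
  \<comment> \<open>This is \<open>ln s \<le> s - 1\<close> at \<open>s = t / a\<close>; scaling by
    \<open>a\<close> gives the claim.\<close>
  have "ln (t / a) \<le> t / a - 1"
    using assms by (intro ln_le_minus_one) simp
  then have "a * ln (t / a) \<le> a * (t / a - 1)"
    using assms by (intro mult_left_mono) auto
  moreover have "ln (t / a) = ln t - ln a"
    using assms by (simp add: ln_div)
  ultimately show ?thesis
    using assms by (simp add: algebra_simps)
qed

lemma ln_eq_minus_one_iff:
  fixes x :: real
  assumes "0 < x"
  shows "ln x = x - 1 \<longleftrightarrow> x = 1"
  using ln_eq_minus_one[OF assms] by auto

section \<open>Integration against a probability density\<close>

context
  fixes M :: "'x measure" and p :: "'x \<Rightarrow> real"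
  assumes p: "prob_density M p"
begin

lemma prob_density_measurable: "p \<in> borel_measurable M"
  and prob_density_nonneg: "x \<in> space M \<Longrightarrow> 0 \<le> p x"
  and prob_density_prob_space: "prob_space (density M (\<lambda>x. ennreal (p x)))"
  using p by (auto simp: prob_density_def)

lemma prob_density_integral_eq:
  fixes f :: "'x \<Rightarrow> real"
  assumes "f \<in> borel_measurable M"
  shows "(\<integral>x. f x \<partial>density M (\<lambda>x. ennreal (p x))) = (\<integral>x. p x * f x \<partial>M)"
    and "integrable (density M (\<lambda>x. ennreal (p x))) f \<longleftrightarrow> integrable M (\<lambda>x. p x * f x)"
  using assms prob_density_measurable prob_density_nonneg
  by (simp_all add: integral_density integrable_density)

lemma prob_density_has_integral: "integrable M p" "(\<integral>x. p x \<partial>M) = 1"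
proof -
  interpret prob_space "density M (\<lambda>x. ennreal (p x))"
    by (rule prob_density_prob_space)
  show "integrable M p" "(\<integral>x. p x \<partial>M) = 1"
    using prob_density_integral_eq[of "\<lambda>_. 1"] prob_space by simp_all
qed

text \<open>A strictly positive density has the null sets of \<open>M\<close>. Almost everywhere
  statements can thus pass between \<open>M\<close>, the data distribution and the generator
  distribution.\<close>

lemma AE_prob_density_iff:
  assumes "\<forall>x\<in>space M. 0 < p x"
  shows "(AE x in density M (\<lambda>x. ennreal (p x)). P x) \<longleftrightarrow> (AE x in M. P x)"
  using assms prob_density_measurable by (subst AE_density) (auto intro!: AE_cong)

end

section \<open>Comparison of two densities and the Kullback-Leibler divergence\<close>

lemma prob_density_ratio:
  assumes p: "prob_density M p" and q: "prob_density M q"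
    and all_pos: "\<forall>x\<in>space M. 0 < q x"
  shows "integrable (density M (\<lambda>x. ennreal (q x))) (\<lambda>x. p x / q x)"
    and "(\<integral>x. p x / q x \<partial>density M (\<lambda>x. ennreal (q x))) = 1"
proof -
  note pos = bspec[OF all_pos]
  note [measurable] = prob_density_measurable[OF p] prob_density_measurable[OF q]
  \<comment> \<open>Positivity matters here: since \<open>a / 0 = 0\<close>, the mass of
    \<open>p\<close> on the zeros of \<open>q\<close> would otherwise be lost.\<close>
  have eq: "q x * (p x / q x) = p x" if "x \<in> space M" for x
    using pos[OF that] by simp
  have "integrable M (\<lambda>x. q x * (p x / q x))"
    using prob_density_has_integral(1)[OF p] eq by (subst Bochner_Integration.integrable_cong) auto
  then show "integrable (density M (\<lambda>x. ennreal (q x))) (\<lambda>x. p x / q x)"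
    by (subst prob_density_integral_eq(2)[OF q]) auto
  have "(\<integral>x. q x * (p x / q x) \<partial>M) = 1"
    using prob_density_has_integral(2)[OF p] eq by (subst Bochner_Integration.integral_cong) auto
  then show "(\<integral>x. p x / q x \<partial>density M (\<lambda>x. ennreal (q x))) = 1"
    by (subst prob_density_integral_eq(1)[OF q]) auto
qed

text \<open>Both densities have integral 1, so the nonnegative difference \<open>q - p\<close> has
  integral 0.\<close>

lemma prob_density_le_imp_eq:
  assumes p: "prob_density M p" and q: "prob_density M q" and le: "AE x in M. p x \<le> q x"
  shows "AE x in M. p x = q x"
proof -
  have "(\<integral>x. q x - p x \<partial>M) = 0" "integrable M (\<lambda>x. q x - p x)"
    using prob_density_has_integral[OF p] prob_density_has_integral[OF q] by auto
  then have "AE x in M. q x - p x = 0"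
    using le by (subst integral_nonneg_eq_0_iff_AE[symmetric]) auto
  then show ?thesis by auto
qed

text \<open>Under \<open>p\<close> the ratio \<open>q / p\<close> has mean 1, so adding
  \<open>q / p - 1\<close> to the integrand leaves the divergence unchanged and makes the integrand
  nonnegative pointwise, with zeros only where \<open>p = q\<close>. This gives the sign and the
  equality case together.\<close>

lemma KL_nonneg:
  assumes p: "prob_density M p" and q: "prob_density M q"
    and all_pos: "\<forall>x\<in>space M. 0 < p x" "\<forall>x\<in>space M. 0 < q x"
    and int: "integrable (density M (\<lambda>x. ennreal (p x))) (\<lambda>x. ln (p x / q x))"
  shows "0 \<le> (\<integral>x. ln (p x / q x) \<partial>density M (\<lambda>x. ennreal (p x)))"
    and "(\<integral>x. ln (p x / q x) \<partial>density M (\<lambda>x. ennreal (p x))) = 0 \<Longrightarrow> AE x in M. q x = p x"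
proof -
  let ?P = "density M (\<lambda>x. ennreal (p x))"
  interpret P: prob_space ?P by (rule prob_density_prob_space[OF p])
  note pos = all_pos[THEN bspec]
  let ?g = "\<lambda>x. ln (p x / q x) - 1 + q x / p x"
  have ln: "ln (p x / q x) = - ln (q x / p x)" if "x \<in> space M" for x
    using pos[OF that] by (simp add: ln_div)
  have nonneg: "0 \<le> ?g x" if "x \<in> space M" for x
    using ln_le_minus_one[of "q x / p x"] pos[OF that] ln[OF that] by simp
  note r = prob_density_ratio[OF q p all_pos(1)]
  have int_g: "integrable ?P ?g"
    using int r(1) by simp
  have eq: "(\<integral>x. ?g x \<partial>?P) = (\<integral>x. ln (p x / q x) \<partial>?P)"
    using int r P.prob_space by simp
  show "0 \<le> (\<integral>x. ln (p x / q x) \<partial>?P)"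
    unfolding eq[symmetric] using nonneg by (intro Bochner_Integration.integral_nonneg) simp
  assume "(\<integral>x. ln (p x / q x) \<partial>?P) = 0"
  then have "AE x in ?P. ?g x = 0"
    using eq int_g nonneg by (subst integral_nonneg_eq_0_iff_AE[symmetric]) auto
  then have "AE x in M. ?g x = 0"
    using AE_prob_density_iff[OF p all_pos(1)] by simp
  then show "AE x in M. q x = p x"
  proof (rule AE_mp, intro AE_I2 impI)
    fix x assume x: "x \<in> space M" "?g x = 0"
    then have "ln (q x / p x) = q x / p x - 1" using ln by simp
    then show "q x = p x"
      using pos[OF x(1)] ln_eq_minus_one_iff[of "q x / p x"] by simp
  qed
qed

section \<open>The payoff in terms of the density of the generator\<close>

lemma induces_densityD:
  assumes "induces_density N M G p"
  shows "prob_density M p" "G \<in> measurable N M"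
    "distr N M G = density M (\<lambda>x. ennreal (p x))" "generator N M G"
  using assms by (auto simp: induces_density_def generator_def distributed_def)

lemma expectation_generator:
  fixes f :: "'x \<Rightarrow> real"
  assumes G: "induces_density N M G p" and f: "f \<in> borel_measurable M"
  shows "(\<integral>z. f (G z) \<partial>N) = (\<integral>x. f x \<partial>density M (\<lambda>x. ennreal (p x)))"
    and "integrable N (\<lambda>z. f (G z)) \<longleftrightarrow> integrable (density M (\<lambda>x. ennreal (p x))) f"
  using induces_densityD(2,3)[OF G] f
  by (simp_all add: integral_distr integrable_distr_eq flip: induces_densityD(3)[OF G])

lemma objective_eq:
  assumes G: "induces_density N M G q"
    and D: "discriminator M D1" "discriminator M D2"
  shows "objective \<alpha> \<beta> N M p G D1 D2 =
     \<alpha> * (\<integral>x. ln (D1 x) \<partial>density M (\<lambda>x. ennreal (p x)))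
     - (\<integral>x. D1 x \<partial>density M (\<lambda>x. ennreal (q x)))
     - (\<integral>x. D2 x \<partial>density M (\<lambda>x. ennreal (p x)))
     + \<beta> * (\<integral>x. ln (D2 x) \<partial>density M (\<lambda>x. ennreal (q x)))"
proof -
  have [measurable]: "D1 \<in> borel_measurable M" "D2 \<in> borel_measurable M"
    using D by (auto simp: discriminator_def)
  show ?thesis
    by (simp add: objective_def expectation_generator(1)[OF G, of D1]
        expectation_generator(1)[OF G, of "\<lambda>x. ln (D2 x)"])
qed

text \<open>Constancy is required under both distributions because each discriminator is averaged
  over both. The almost everywhere form is what an arbitrary solution provides, where
  \<open>q = p\<close> holds only up to a null set.\<close>

lemma objective_AE_const:
  assumes G: "induces_density N M G q" and p: "prob_density M p"
    and D: "discriminator M D1" "discriminator M D2"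
    and P: "AE x in density M (\<lambda>x. ennreal (p x)). D1 x = \<alpha> \<and> D2 x = \<beta>"
    and Q: "AE x in density M (\<lambda>x. ennreal (q x)). D1 x = \<alpha> \<and> D2 x = \<beta>"
  shows "admissible N M p G D1 D2"
    and "objective \<alpha> \<beta> N M p G D1 D2 = \<alpha> * (ln \<alpha> - 1) + \<beta> * (ln \<beta> - 1)"
proof -
  let ?P = "density M (\<lambda>x. ennreal (p x))" and ?Q = "density M (\<lambda>x. ennreal (q x))"
  interpret P: prob_space ?P by (rule prob_density_prob_space[OF p])
  interpret Q: prob_space ?Q by (rule prob_density_prob_space[OF induces_densityD(1)[OF G]])
  have [measurable]: "D1 \<in> borel_measurable M" "D2 \<in> borel_measurable M"
    using D by (auto simp: discriminator_def)
  \<comment> \<open>A function \<open>f\<close> of both scores covers the four integrands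
    \<open>D1\<close>, \<open>D2\<close>, \<open>ln D1\<close> and \<open>ln D2\<close> at
    once.\<close>
  have has_int: "integrable ?P (\<lambda>x. f (D1 x) (D2 x)) \<and> (\<integral>x. f (D1 x) (D2 x) \<partial>?P) = f \<alpha> \<beta>"
    "integrable ?Q (\<lambda>x. f (D1 x) (D2 x)) \<and> (\<integral>x. f (D1 x) (D2 x) \<partial>?Q) = f \<alpha> \<beta>"
    if [measurable]: "case_prod f \<in> borel_measurable (borel \<Otimes>\<^sub>M borel)" for f :: "real \<Rightarrow> real \<Rightarrow> real"
  proof -
    have [measurable]: "(\<lambda>x. f (D1 x) (D2 x)) \<in> borel_measurable M" by measurable
    show "integrable ?P (\<lambda>x. f (D1 x) (D2 x)) \<and> (\<integral>x. f (D1 x) (D2 x) \<partial>?P) = f \<alpha> \<beta>"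
    proof -
      have "AE x in ?P. f (D1 x) (D2 x) = f \<alpha> \<beta>"
        using P by (rule AE_mp) auto
      then show ?thesis
        using P.prob_space integrable_cong_AE[of "\<lambda>x. f (D1 x) (D2 x)" ?P "\<lambda>_. f \<alpha> \<beta>"]
          integral_cong_AE[of "\<lambda>x. f (D1 x) (D2 x)" ?P "\<lambda>_. f \<alpha> \<beta>"] by simp
    qed
    show "integrable ?Q (\<lambda>x. f (D1 x) (D2 x)) \<and> (\<integral>x. f (D1 x) (D2 x) \<partial>?Q) = f \<alpha> \<beta>"
    proof -
      have "AE x in ?Q. f (D1 x) (D2 x) = f \<alpha> \<beta>"
        using Q by (rule AE_mp) auto
      then show ?thesis
        using Q.prob_space integrable_cong_AE[of "\<lambda>x. f (D1 x) (D2 x)" ?Q "\<lambda>_. f \<alpha> \<beta>"]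
          integral_cong_AE[of "\<lambda>x. f (D1 x) (D2 x)" ?Q "\<lambda>_. f \<alpha> \<beta>"] by simp
    qed
  qed
  note i = has_int[of "\<lambda>s t. s"] has_int[of "\<lambda>s t. t"] has_int[of "\<lambda>s t. ln s"] has_int[of "\<lambda>s t. ln t"]
  show "admissible N M p G D1 D2"
    unfolding admissible_def using i D induces_densityD(4)[OF G]
    by (simp add: expectation_generator(2)[OF G, of D1]
        expectation_generator(2)[OF G, of "\<lambda>x. ln (D2 x)"])
  show "objective \<alpha> \<beta> N M p G D1 D2 = \<alpha> * (ln \<alpha> - 1) + \<beta> * (ln \<beta> - 1)"
    using i by (simp add: objective_eq[OF G D] algebra_simps)
qed

text \<open>Averaging a constant gives the same value under every distribution, so the generator
  cannot influence the payoff. Constancy is asked only on \<open>space M\<close>, since outside it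
  the data density may vanish and the optimal discriminators against it need not be
  constant.\<close>

lemma objective_const:
  assumes G: "generator N M G" and p: "prob_density M p"
    and D: "discriminator M D1" "discriminator M D2"
    and const: "\<And>x. x \<in> space M \<Longrightarrow> D1 x = \<alpha>" "\<And>x. x \<in> space M \<Longrightarrow> D2 x = \<beta>"
  shows "admissible N M p G D1 D2"
    and "objective \<alpha> \<beta> N M p G D1 D2 = \<alpha> * (ln \<alpha> - 1) + \<beta> * (ln \<beta> - 1)"
proof -
  obtain q where q: "induces_density N M G q"
    using G by (auto simp: generator_def)
  have "AE x in density M f. D1 x = \<alpha> \<and> D2 x = \<beta>" for f
    using const by (intro AE_I2) auto
  then show "admissible N M p G D1 D2"
    "objective \<alpha> \<beta> N M p G D1 D2 = \<alpha> * (ln \<alpha> - 1) + \<beta> * (ln \<beta> - 1)"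
    using objective_AE_const[OF q p D] by blast+
qed

text \<open>When the generator reproduces \<open>p\<close>, all four expectations are over the same
  distribution. The payoff is then the mean of \<open>\<alpha> ln D1 - D1\<close> plus the mean of
  \<open>\<beta> ln D2 - D2\<close>, and each is bounded pointwise.\<close>

lemma objective_le:
  assumes G: "induces_density N M G p" and adm: "admissible N M p G D1 D2"
    and ab: "0 < \<alpha>" "0 < \<beta>"
  shows "objective \<alpha> \<beta> N M p G D1 D2 \<le> \<alpha> * (ln \<alpha> - 1) + \<beta> * (ln \<beta> - 1)"
proof -
  let ?P = "density M (\<lambda>x. ennreal (p x))"
  interpret P: prob_space ?P by (rule prob_density_prob_space[OF induces_densityD(1)[OF G]])
  have D: "discriminator M D1" "discriminator M D2"
    using adm by (auto simp: admissible_def)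
  have [measurable]: "D1 \<in> borel_measurable M" "D2 \<in> borel_measurable M"
    using D by (auto simp: discriminator_def)
  have int: "integrable ?P D1" "integrable ?P D2"
    "integrable ?P (\<lambda>x. ln (D1 x))" "integrable ?P (\<lambda>x. ln (D2 x))"
    using adm by (auto simp: admissible_def expectation_generator(2)[OF G, of D1]
        expectation_generator(2)[OF G, of "\<lambda>x. ln (D2 x)"])
  have le: "(\<integral>x. a * ln (E x) - E x \<partial>?P) \<le> a * (ln a - 1)"
    if "0 < a" "integrable ?P E" "integrable ?P (\<lambda>x. ln (E x))" "discriminator M E" for a E
    using that by (intro P.integral_le_const)
      (auto intro!: payoff_le AE_I2 simp: discriminator_def)
  show ?thesis
    using le[OF ab(1) int(1,3) D(1)] le[OF ab(2) int(2,4) D(2)] int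
    by (simp add: objective_eq[OF G D])
qed

text \<open>The linear terms are means of density ratios, hence equal to \<alpha> and \<beta>, and
  the logarithms split off \<open>ln \<alpha>\<close> and \<open>ln \<beta>\<close>. What remains is
  the weighted sum of the two divergences. Their finiteness and the positivity of \<open>q\<close>
  are extracted from admissibility.\<close>

lemma objective_opt:
  assumes p: "prob_density M p" and all_pos: "\<forall>x\<in>space M. 0 < p x"
    and G: "induces_density N M G q"
    and adm: "admissible N M p G (opt_D1 \<alpha> p q) (opt_D2 \<beta> p q)"
    and ab: "0 < \<alpha>" "0 < \<beta>"
  shows "\<forall>x\<in>space M. 0 < q x"
    and "integrable (density M (\<lambda>x. ennreal (p x))) (\<lambda>x. ln (p x / q x))"
    and "integrable (density M (\<lambda>x. ennreal (q x))) (\<lambda>x. ln (q x / p x))"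
    and "objective \<alpha> \<beta> N M p G (opt_D1 \<alpha> p q) (opt_D2 \<beta> p q) =
      \<alpha> * (ln \<alpha> - 1) + \<beta> * (ln \<beta> - 1)
      + \<alpha> * (\<integral>x. ln (p x / q x) \<partial>density M (\<lambda>x. ennreal (p x)))
      + \<beta> * (\<integral>x. ln (q x / p x) \<partial>density M (\<lambda>x. ennreal (q x)))"
proof -
  let ?P = "density M (\<lambda>x. ennreal (p x))" and ?Q = "density M (\<lambda>x. ennreal (q x))"
  note q = induces_densityD(1)[OF G]
  interpret P: prob_space ?P by (rule prob_density_prob_space[OF p])
  interpret Q: prob_space ?Q by (rule prob_density_prob_space[OF q])
  have D: "discriminator M (opt_D1 \<alpha> p q)" "discriminator M (opt_D2 \<beta> p q)"
    using adm by (auto simp: admissible_def)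
  have [measurable]: "opt_D1 \<alpha> p q \<in> borel_measurable M" "opt_D2 \<beta> p q \<in> borel_measurable M"
    using D by (auto simp: discriminator_def)
  note pos = bspec[OF all_pos]
  show all_qpos: "\<forall>x\<in>space M. 0 < q x"
  proof
    fix x assume that: "x \<in> space M"
    \<comment> \<open>As a discriminator, \<open>opt_D2\<close> is strictly positive, which excludes
      zeros of \<open>q\<close>.\<close>
    have "0 < \<beta> * q x / p x"
      using D(2) that by (auto simp: discriminator_def opt_D2_def)
    then show "0 < q x"
      using pos[OF that] ab by (simp add: zero_less_mult_iff zero_less_divide_iff)
  qed
  note qpos = bspec[OF all_qpos]
  have ln: "ln (opt_D1 \<alpha> p q x) = ln \<alpha> + ln (p x / q x)"
    "ln (opt_D2 \<beta> p q x) = ln \<beta> + ln (q x / p x)" if "x \<in> space M" for x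
    using pos[OF that] qpos[OF that] ab ln_mult[of \<alpha> "p x / q x"] ln_mult[of \<beta> "q x / p x"]
    by (simp_all add: opt_D1_def opt_D2_def)
  have "integrable ?P (\<lambda>x. ln (opt_D1 \<alpha> p q x))"
    using adm by (simp add: admissible_def)
  then have "integrable ?P (\<lambda>x. ln \<alpha> + ln (p x / q x))"
    by (subst Bochner_Integration.integrable_cong[OF refl, of _ _ "\<lambda>x. ln (opt_D1 \<alpha> p q x)"])
      (auto simp: ln)
  from Bochner_Integration.integrable_diff[OF this P.integrable_const[of "ln \<alpha>"]]
  show intP: "integrable ?P (\<lambda>x. ln (p x / q x))" by simp
  have "integrable ?Q (\<lambda>x. ln (opt_D2 \<beta> p q x))"
    using adm by (simp add: admissible_def expectation_generator(2)[OF G, of "\<lambda>x. ln (opt_D2 \<beta> p q x)"])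
  then have "integrable ?Q (\<lambda>x. ln \<beta> + ln (q x / p x))"
    by (subst Bochner_Integration.integrable_cong[OF refl, of _ _ "\<lambda>x. ln (opt_D2 \<beta> p q x)"])
      (auto simp: ln)
  from Bochner_Integration.integrable_diff[OF this Q.integrable_const[of "ln \<beta>"]]
  show intQ: "integrable ?Q (\<lambda>x. ln (q x / p x))" by simp
  have "(\<integral>x. ln (opt_D1 \<alpha> p q x) \<partial>?P) = (\<integral>x. ln \<alpha> + ln (p x / q x) \<partial>?P)"
    by (intro Bochner_Integration.integral_cong) (auto simp: ln)
  moreover have "(\<integral>x. ln (opt_D2 \<beta> p q x) \<partial>?Q) = (\<integral>x. ln \<beta> + ln (q x / p x) \<partial>?Q)"
    by (intro Bochner_Integration.integral_cong) (auto simp: ln)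
  moreover have "(\<integral>x. opt_D1 \<alpha> p q x \<partial>?Q) = \<alpha>"
    using prob_density_ratio(2)[OF p q all_qpos] by (simp add: opt_D1_def flip: times_divide_eq_right)
  moreover have "(\<integral>x. opt_D2 \<beta> p q x \<partial>?P) = \<beta>"
    using prob_density_ratio(2)[OF q p all_pos] by (simp add: opt_D2_def flip: times_divide_eq_right)
  ultimately show "objective \<alpha> \<beta> N M p G (opt_D1 \<alpha> p q) (opt_D2 \<beta> p q) =
      \<alpha> * (ln \<alpha> - 1) + \<beta> * (ln \<beta> - 1)
      + \<alpha> * (\<integral>x. ln (p x / q x) \<partial>?P) + \<beta> * (\<integral>x. ln (q x / p x) \<partial>?Q)"
    using intP intQ P.prob_space Q.prob_space by (simp add: objective_eq[OF G D] algebra_simps)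
qed

text \<open>The excess over the bound is a sum of two nonnegative multiples of divergences, so the
  divergence of \<open>p\<close> from \<open>q\<close> must vanish; that one alone forces
  equality.\<close>

lemma objective_opt_le_imp_AE_eq:
  assumes p: "prob_density M p" and all_pos: "\<forall>x\<in>space M. 0 < p x"
    and G: "induces_density N M G q"
    and adm: "admissible N M p G (opt_D1 \<alpha> p q) (opt_D2 \<beta> p q)"
    and ab: "0 < \<alpha>" "0 < \<beta>"
    and le: "objective \<alpha> \<beta> N M p G (opt_D1 \<alpha> p q) (opt_D2 \<beta> p q)
      \<le> \<alpha> * (ln \<alpha> - 1) + \<beta> * (ln \<beta> - 1)"
  shows "AE x in M. q x = p x"
proof -
  note q = induces_densityD(1)[OF G]
  note opt = objective_opt[OF p all_pos G adm ab]
  note KL = KL_nonneg[OF p q all_pos opt(1,2)]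
  note KL' = KL_nonneg(1)[OF q p opt(1) all_pos opt(3)]
  have "0 \<le> \<beta> * (\<integral>x. ln (q x / p x) \<partial>density M (\<lambda>x. ennreal (q x)))"
    using KL' ab by (intro mult_nonneg_nonneg) auto
  then have "\<alpha> * (\<integral>x. ln (p x / q x) \<partial>density M (\<lambda>x. ennreal (p x))) \<le> 0"
    using le opt(4) by linarith
  then have "(\<integral>x. ln (p x / q x) \<partial>density M (\<lambda>x. ennreal (p x))) = 0"
    using KL(1) ab by (auto simp: mult_le_0_iff)
  from KL(2)[OF this] show ?thesis .
qed

section \<open>Conditioning a density on an event, and Nash equilibria\<close>

lemma prob_density_restrict:
  fixes f :: "'x \<Rightarrow> real"
  assumes q: "prob_density M q" and A: "A \<in> sets M"
    and c: "c = measure (density M (\<lambda>x. ennreal (q x))) A" "0 < c"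
  shows "prob_density M (\<lambda>x. indicator A x * q x / c)" (is "prob_density M ?r")
    and "f \<in> borel_measurable M \<Longrightarrow> integrable (density M (\<lambda>x. ennreal (q x))) f \<Longrightarrow>
      integrable (density M (\<lambda>x. ennreal (indicator A x * q x / c))) f"
    and "f \<in> borel_measurable M \<Longrightarrow>
      (\<integral>x. f x \<partial>density M (\<lambda>x. ennreal (indicator A x * q x / c))) =
      (\<integral>x. indicator A x * f x \<partial>density M (\<lambda>x. ennreal (q x))) / c"
proof -
  let ?Q = "density M (\<lambda>x. ennreal (q x))" and ?R = "density M (\<lambda>x. ennreal (?r x))"
  interpret Q: prob_space ?Q by (rule prob_density_prob_space[OF q])
  note [measurable] = prob_density_measurable[OF q] A
  have nonneg: "0 \<le> ?r x" if "x \<in> space M" for x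
    using prob_density_nonneg[OF q that] c by (auto simp: indicator_def)
  have "emeasure ?R (space ?R) = (\<integral>\<^sup>+x. ennreal (?r x) \<partial>M)"
    by (simp add: emeasure_density cong: nn_integral_cong)
  also have "\<dots> = (\<integral>\<^sup>+x. ennreal (q x) * indicator A x / c \<partial>M)"
    using c prob_density_nonneg[OF q]
    by (intro nn_integral_cong) (auto simp: indicator_def divide_ennreal)
  also have "\<dots> = emeasure ?Q A / c"
    by (simp add: nn_integral_divide emeasure_density)
  also have "\<dots> = 1"
    using c by (simp add: Q.emeasure_eq_measure divide_ennreal)
  finally show r: "prob_density M ?r"
    using nonneg by (auto simp: prob_density_def intro!: prob_spaceI)
  fix f :: "'x \<Rightarrow> real" assume f[measurable]: "f \<in> borel_measurable M"
  have eq: "?r x * f x = (q x * (indicator A x * f x)) / c" for x by simp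
  \<comment> \<open>The conditioned density is at most \<open>q / c\<close>, so it inherits
    integrability. This is what will make the deviation of the generator admissible.\<close>
  show "integrable ?R f" if "integrable ?Q f"
    using that integrable_mult_indicator[of A M "\<lambda>x. q x * f x"]
    unfolding prob_density_integral_eq(2)[OF r f] prob_density_integral_eq(2)[OF q f] eq
    by (simp add: mult.left_commute)
  have "(\<lambda>x. indicator A x * f x) \<in> borel_measurable M" by measurable
  then show "(\<integral>x. f x \<partial>?R) = (\<integral>x. indicator A x * f x \<partial>?Q) / c"
    unfolding prob_density_integral_eq(1)[OF r f] eq
    by (simp add: prob_density_integral_eq(1)[OF q])
qed

text \<open>
  With the discriminators fixed, the generator minimizes the expectation of a strictly decreasing
  function of \<open>p / q\<close>. The density \<open>p\<close> itself need not be an admissible deviation, since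
  \<open>p\<^sup>2 / q\<close> may fail to be integrable; conditioning \<open>q\<close> on \<open>{q < p}\<close> always is.
\<close>

lemma nash_imp_AE_eq:
  assumes p: "prob_density M p" and all_pos: "\<forall>x\<in>space M. 0 < p x"
    and cap: "enough_capacity N M"
    and G: "induces_density N M G q"
    and nash: "nash_equilibrium \<alpha> \<beta> N M p G (opt_D1 \<alpha> p q) (opt_D2 \<beta> p q)"
    and ab: "0 < \<alpha>" "0 < \<beta>"
  shows "AE x in M. q x = p x"
proof -
  let ?Q = "density M (\<lambda>x. ennreal (q x))"
  let ?D1 = "opt_D1 \<alpha> p q" and ?D2 = "opt_D2 \<beta> p q"
  define A where "A = {x\<in>space M. q x < p x}"
  define c where "c = measure ?Q A"
  \<comment> \<open>This is the integrand through which the generator enters the objective, shifted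
    by constants so that it vanishes where \<open>q = p\<close>. On \<open>space M\<close> it is
    negative exactly on \<open>A\<close>.\<close>
  define \<psi> where "\<psi> x = \<beta> * (ln (?D2 x) - ln \<beta>) - (?D1 x - \<alpha>)" for x
  have adm: "admissible N M p G ?D1 ?D2"
    using nash by (simp add: nash_equilibrium_def)
  note q = induces_densityD(1)[OF G]
  note all_qpos = objective_opt(1)[OF p all_pos G adm ab]
  note pos = bspec[OF all_pos] and qpos = bspec[OF all_qpos]
  interpret Q: prob_space ?Q by (rule prob_density_prob_space[OF q])
  have D: "discriminator M ?D1" "discriminator M ?D2"
    using adm by (auto simp: admissible_def)
  note [measurable] = prob_density_measurable[OF p] prob_density_measurable[OF q]
  have [measurable]: "?D1 \<in> borel_measurable M" "?D2 \<in> borel_measurable M"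
    using D by (auto simp: discriminator_def)
  have A[measurable]: "A \<in> sets M" unfolding A_def by measurable
  have [measurable]: "\<psi> \<in> borel_measurable M" unfolding \<psi>_def by measurable
  have intQ: "integrable ?Q ?D1" "integrable ?Q (\<lambda>x. ln (?D2 x))"
    using adm by (simp_all add: admissible_def expectation_generator(2)[OF G, of ?D1]
        expectation_generator(2)[OF G, of "\<lambda>x. ln (?D2 x)"])
  then have int\<psi>: "integrable ?Q \<psi>" unfolding \<psi>_def by simp
  have \<psi>_eq: "\<psi> x = \<beta> * ln (q x / p x) - \<alpha> * (p x / q x - 1)" if "x \<in> space M" for x
    using pos[OF that] qpos[OF that] ab ln_mult[of \<beta> "q x / p x"]
    by (simp add: \<psi>_def opt_D1_def opt_D2_def algebra_simps)
  have \<psi>_neg: "\<psi> x < 0" if "x \<in> A" for x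
  proof -
    have x: "x \<in> space M" "q x < p x" using that by (auto simp: A_def)
    then have "ln (q x / p x) < 0" "0 < p x / q x - 1"
      using pos[OF x(1)] qpos[OF x(1)] by (auto simp: ln_less_zero_iff)
    then have "\<beta> * ln (q x / p x) < 0" "0 < \<alpha> * (p x / q x - 1)"
      using ab by (auto intro: mult_pos_neg)
    then show ?thesis using \<psi>_eq[OF x(1)] by linarith
  qed
  have \<psi>_nonneg: "0 \<le> \<psi> x" if "x \<in> space M" "x \<notin> A" for x
  proof -
    have "p x \<le> q x" using that by (auto simp: A_def)
    then have "0 \<le> ln (q x / p x)" "p x / q x - 1 \<le> 0"
      using pos[OF that(1)] qpos[OF that(1)] by auto
    then have "0 \<le> \<beta> * ln (q x / p x)" "\<alpha> * (p x / q x - 1) \<le> 0"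
      using ab by (auto intro: mult_nonneg_nonneg mult_nonneg_nonpos)
    then show ?thesis using \<psi>_eq[OF that(1)] by linarith
  qed
  \<comment> \<open>The extreme cases give \<open>p \<le> q\<close> or \<open>q \<le> p\<close>
    almost everywhere, and equal total mass then gives equality. The intermediate case is
    contradictory.\<close>
  consider "c = 0" | "c = 1" | "0 < c" "c < 1"
    using Q.prob_le_1[of A] measure_nonneg[of ?Q A] unfolding c_def by linarith
  then show ?thesis
  proof cases
    case 1
    then have "AE x in ?Q. x \<notin> A"
      by (subst AE_iff_measurable[where N = A])
        (auto simp: c_def Q.emeasure_eq_measure A_def)
    then have "AE x in M. p x \<le> q x"
      unfolding AE_prob_density_iff[OF q all_qpos] by (rule AE_mp) (auto simp: A_def)
    from prob_density_le_imp_eq[OF p q this] show ?thesis by auto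
  next
    case 2
    then have "AE x in ?Q. x \<in> A"
      by (subst Q.prob_eq_1[symmetric]) (auto simp: c_def)
    then have "AE x in M. q x \<le> p x"
      unfolding AE_prob_density_iff[OF q all_qpos] by (rule AE_mp) (auto simp: A_def)
    from prob_density_le_imp_eq[OF q p this] show ?thesis .
  next
    case 3
    \<comment> \<open>The deviation moves all mass to the event \<open>A\<close>, where
      \<open>\<psi>\<close> is negative.\<close>
    define r where "r x = indicator A x * q x / c" for x
    let ?R = "density M (\<lambda>x. ennreal (r x))"
    note restr = prob_density_restrict[OF q A c_def 3(1), folded r_def]
    obtain G' where G': "induces_density N M G' r"
      using cap restr(1) by (auto simp: enough_capacity_def)
    interpret R: prob_space ?R by (rule prob_density_prob_space[OF restr(1)])
    have intR: "integrable ?R ?D1" "integrable ?R (\<lambda>x. ln (?D2 x))"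
      using intQ by (auto intro: restr(2))
    have "admissible N M p G' ?D1 ?D2"
      using adm intR induces_densityD(4)[OF G']
      by (simp add: admissible_def expectation_generator(2)[OF G', of ?D1]
          expectation_generator(2)[OF G', of "\<lambda>x. ln (?D2 x)"])
    then have "objective \<alpha> \<beta> N M p G ?D1 ?D2 \<le> objective \<alpha> \<beta> N M p G' ?D1 ?D2"
      using nash by (simp add: nash_equilibrium_def)
    \<comment> \<open>The terms averaged over the data cancel, and the constant shifts in
      \<open>\<psi>\<close> agree on both sides because both measures have mass 1.\<close>
    then have "(\<integral>x. \<psi> x \<partial>?Q) \<le> (\<integral>x. \<psi> x \<partial>?R)"
      using intQ intR Q.prob_space R.prob_space
      by (simp add: objective_eq[OF G D] objective_eq[OF G' D] \<psi>_def algebra_simps)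
    also have "\<dots> = (\<integral>x. indicator A x * \<psi> x \<partial>?Q) / c"
      by (intro restr(3)) measurable
    finally have le: "c * (\<integral>x. \<psi> x \<partial>?Q) \<le> (\<integral>x. indicator A x * \<psi> x \<partial>?Q)"
      using 3 by (simp add: field_simps)
    \<comment> \<open>On \<open>A\<close> this is \<open>- (1 - c) * \<psi> x\<close>, which is
      positive; elsewhere on \<open>space M\<close> it is \<open>c * \<psi> x\<close>, which is
      nonnegative. By \<open>le\<close> its integral is at most 0, so \<open>A\<close> is a null set
      for \<open>q\<close>, against \<open>0 < c\<close>.\<close>
    let ?g = "\<lambda>x. c * \<psi> x - indicator A x * \<psi> x"
    have int: "integrable ?Q (\<lambda>x. indicator A x * \<psi> x)"
      using integrable_mult_indicator[OF _ int\<psi>, of A] by simp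
    have nonneg: "0 \<le> ?g x" if "x \<in> space M" for x
    proof (cases "x \<in> A")
      case True
      then have "(1 - c) * \<psi> x \<le> 0"
        using \<psi>_neg 3 by (intro mult_nonneg_nonpos) (auto intro: less_imp_le)
      then show ?thesis using True by (simp add: algebra_simps)
    qed (use \<psi>_nonneg that 3 in auto)
    have "(\<integral>x. ?g x \<partial>?Q) = 0"
      using le int int\<psi> nonneg Bochner_Integration.integral_nonneg[of ?Q ?g] by simp
    then have "AE x in ?Q. ?g x = 0"
      using int int\<psi> nonneg by (subst integral_nonneg_eq_0_iff_AE[symmetric]) auto
    then have "AE x in ?Q. x \<notin> A"
    proof (rule AE_mp, intro AE_I2 impI notI)
      fix x assume "?g x = 0" "x \<in> A"
      then have "(1 - c) * \<psi> x = 0" by (simp add: algebra_simps)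
      then show False using \<psi>_neg[OF \<open>x \<in> A\<close>] 3 by simp
    qed
    then have "c = 0"
      unfolding c_def by (intro Q.prob_eq_0[THEN iffD2]) auto
    then show ?thesis using 3 by simp
  qed
qed

section \<open>The inner maximum and the equilibrium\<close>

lemma inner_max_ge:
  assumes G: "generator N M G" and p: "prob_density M p" and ab: "0 < \<alpha>" "0 < \<beta>"
  shows "ereal (\<alpha> * (ln \<alpha> - 1) + \<beta> * (ln \<beta> - 1)) \<le> inner_max \<alpha> \<beta> N M p G"
proof -
  have "discriminator M (\<lambda>_. \<alpha>)" "discriminator M (\<lambda>_. \<beta>)"
    using ab by (auto simp: discriminator_def)
  from objective_const[OF G p this] show ?thesis
    unfolding inner_max_def by (intro SUP_upper2[of "(\<lambda>_. \<alpha>, \<lambda>_. \<beta>)"]) auto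
qed

lemma inner_max_data:
  assumes G: "induces_density N M G p" and ab: "0 < \<alpha>" "0 < \<beta>"
  shows "inner_max \<alpha> \<beta> N M p G = ereal (\<alpha> * (ln \<alpha> - 1) + \<beta> * (ln \<beta> - 1))"
proof (rule antisym)
  show "inner_max \<alpha> \<beta> N M p G \<le> ereal (\<alpha> * (ln \<alpha> - 1) + \<beta> * (ln \<beta> - 1))"
    unfolding inner_max_def using objective_le[OF G _ ab] by (intro SUP_least) auto
qed (use inner_max_ge[OF induces_densityD(4,1)[OF G] ab] in simp)

theorem theorem2:
  fixes M :: "'x measure" and N :: "'z measure"
    and p_data :: "'x \<Rightarrow> real" and \<alpha> \<beta> :: real
  assumes "sigma_finite_measure M" and "prob_space N"
    and "prob_density M p_data" and "\<And>x. x \<in> space M \<Longrightarrow> 0 < p_data x"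
    and "enough_capacity N M"
    and "0 < \<alpha>" "\<alpha> \<le> 1" "0 < \<beta>" "\<beta> \<le> 1"
  shows
    "(\<exists>G. induces_density N M G p_data
        \<and> minimax_solution \<alpha> \<beta> N M p_data G (opt_D1 \<alpha> p_data p_data) (opt_D2 \<beta> p_data p_data)
        \<and> nash_equilibrium \<alpha> \<beta> N M p_data G (opt_D1 \<alpha> p_data p_data) (opt_D2 \<beta> p_data p_data))
     \<and> (\<forall>G p_G. induces_density N M G p_G
          \<and> (minimax_solution \<alpha> \<beta> N M p_data G (opt_D1 \<alpha> p_data p_G) (opt_D2 \<beta> p_data p_G)
             \<or> nash_equilibrium \<alpha> \<beta> N M p_data G (opt_D1 \<alpha> p_data p_G) (opt_D2 \<beta> p_data p_G))
          \<longrightarrow> objective \<alpha> \<beta> N M p_data G (opt_D1 \<alpha> p_data p_G) (opt_D2 \<beta> p_data p_G)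
                = \<alpha> * (ln \<alpha> - 1) + \<beta> * (ln \<beta> - 1)
            \<and> distr N M G = density M (\<lambda>x. ennreal (p_data x))
            \<and> (AE x in M. p_G x = p_data x)
            \<and> (AE x in M. opt_D1 \<alpha> p_data p_G x = \<alpha> \<and> opt_D2 \<beta> p_data p_G x = \<beta>)
            \<and> (\<forall>x\<in>space M. p_G x = p_data x \<longrightarrow>
                  opt_D1 \<alpha> p_data p_G x = \<alpha> \<and> opt_D2 \<beta> p_data p_G x = \<beta>))"
proof (rule conjI)
  note p = assms(3) and pos = assms(4) and cap = assms(5)
  have ab: "0 < \<alpha>" "0 < \<beta>" using assms by auto
  let ?v = "\<alpha> * (ln \<alpha> - 1) + \<beta> * (ln \<beta> - 1)"
  obtain G\<^sub>0 where G\<^sub>0: "induces_density N M G\<^sub>0 p_data"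
    using cap p by (auto simp: enough_capacity_def)
  have all_pos: "\<forall>x\<in>space M. 0 < p_data x" using pos by blast
  have opt_const: "opt_D1 \<alpha> p_data q x = \<alpha>" "opt_D2 \<beta> p_data q x = \<beta>"
    if "x \<in> space M" "q x = p_data x" for q x
    using pos[OF that(1)] that(2) by (auto simp: opt_D1_def opt_D2_def)
  show "\<exists>G. induces_density N M G p_data
        \<and> minimax_solution \<alpha> \<beta> N M p_data G (opt_D1 \<alpha> p_data p_data) (opt_D2 \<beta> p_data p_data)
        \<and> nash_equilibrium \<alpha> \<beta> N M p_data G (opt_D1 \<alpha> p_data p_data) (opt_D2 \<beta> p_data p_data)"
  proof (intro exI conjI)
    let ?D1 = "opt_D1 \<alpha> p_data p_data" and ?D2 = "opt_D2 \<beta> p_data p_data"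
    note [measurable] = prob_density_measurable[OF p]
    have "?D1 \<in> borel_measurable M" "?D2 \<in> borel_measurable M"
      unfolding opt_D1_def opt_D2_def by measurable
    then have D: "discriminator M ?D1" "discriminator M ?D2"
      using ab by (auto simp: discriminator_def opt_const)
    \<comment> \<open>This holds for every generator: against these discriminators no deviation of
      the generator changes the payoff, which is its share of the Nash condition.\<close>
    have const: "admissible N M p_data G ?D1 ?D2" "objective \<alpha> \<beta> N M p_data G ?D1 ?D2 = ?v"
      if "generator N M G" for G
      using objective_const[OF that p D] opt_const by auto
    note gen = induces_densityD(4)[OF G\<^sub>0]
    show "induces_density N M G\<^sub>0 p_data" by (fact G\<^sub>0)
    show "minimax_solution \<alpha> \<beta> N M p_data G\<^sub>0 ?D1 ?D2"
      unfolding minimax_solution_def inner_max_data[OF G\<^sub>0 ab]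
      using const[OF gen] by (auto intro: inner_max_ge[OF _ p ab])
    show "nash_equilibrium \<alpha> \<beta> N M p_data G\<^sub>0 ?D1 ?D2"
      unfolding nash_equilibrium_def
      using const[OF gen] const(2) objective_le[OF G\<^sub>0 _ ab] by (auto simp: admissible_def)
  qed
  show "\<forall>G p_G. induces_density N M G p_G
          \<and> (minimax_solution \<alpha> \<beta> N M p_data G (opt_D1 \<alpha> p_data p_G) (opt_D2 \<beta> p_data p_G)
             \<or> nash_equilibrium \<alpha> \<beta> N M p_data G (opt_D1 \<alpha> p_data p_G) (opt_D2 \<beta> p_data p_G))
          \<longrightarrow> objective \<alpha> \<beta> N M p_data G (opt_D1 \<alpha> p_data p_G) (opt_D2 \<beta> p_data p_G) = ?v
            \<and> distr N M G = density M (\<lambda>x. ennreal (p_data x))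
            \<and> (AE x in M. p_G x = p_data x)
            \<and> (AE x in M. opt_D1 \<alpha> p_data p_G x = \<alpha> \<and> opt_D2 \<beta> p_data p_G x = \<beta>)
            \<and> (\<forall>x\<in>space M. p_G x = p_data x \<longrightarrow>
                  opt_D1 \<alpha> p_data p_G x = \<alpha> \<and> opt_D2 \<beta> p_data p_G x = \<beta>)"
  proof (intro allI impI, elim conjE)
    fix G q
    let ?D1 = "opt_D1 \<alpha> p_data q" and ?D2 = "opt_D2 \<beta> p_data q"
    assume G: "induces_density N M G q"
      and sol: "minimax_solution \<alpha> \<beta> N M p_data G ?D1 ?D2
        \<or> nash_equilibrium \<alpha> \<beta> N M p_data G ?D1 ?D2"
    note q = induces_densityD(1)[OF G]
    have adm: "admissible N M p_data G ?D1 ?D2"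
      using sol by (auto simp: minimax_solution_def nash_equilibrium_def)
    have eq: "AE x in M. q x = p_data x"
      using sol
    proof
      assume mm: "minimax_solution \<alpha> \<beta> N M p_data G ?D1 ?D2"
      \<comment> \<open>Minimality is tested against the generator of the data density, whose inner
        maximum is exactly \<open>?v\<close>.\<close>
      then have "ereal (objective \<alpha> \<beta> N M p_data G ?D1 ?D2) \<le> inner_max \<alpha> \<beta> N M p_data G\<^sub>0"
        using induces_densityD(4)[OF G\<^sub>0] by (simp add: minimax_solution_def)
      then have "objective \<alpha> \<beta> N M p_data G ?D1 ?D2 \<le> ?v"
        by (simp add: inner_max_data[OF G\<^sub>0 ab])
      then show ?thesis by (rule objective_opt_le_imp_AE_eq[OF p all_pos G adm ab])
    next
      assume "nash_equilibrium \<alpha> \<beta> N M p_data G ?D1 ?D2"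
      then show ?thesis by (rule nash_imp_AE_eq[OF p all_pos cap G _ ab])
    qed
    have D_eq: "AE x in M. ?D1 x = \<alpha> \<and> ?D2 x = \<beta>"
      using eq by (rule AE_mp) (auto simp: opt_const)
    note qpos = objective_opt(1)[OF p all_pos G adm ab]
    \<comment> \<open>Both densities are positive, so constancy almost everywhere in
      \<open>M\<close> carries over to the data and the generator distribution. The value follows in
      the same way for both kinds of solution.\<close>
    have "objective \<alpha> \<beta> N M p_data G ?D1 ?D2 = ?v"
      using adm D_eq
      by (intro objective_AE_const(2)[OF G p])
        (auto simp: admissible_def AE_prob_density_iff[OF p all_pos] AE_prob_density_iff[OF q qpos])
    moreover have "density M (\<lambda>x. ennreal (q x)) = density M (\<lambda>x. ennreal (p_data x))"
      using eq prob_density_measurable[OF p] prob_density_measurable[OF q]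
      by (intro density_cong) auto
    ultimately show "objective \<alpha> \<beta> N M p_data G ?D1 ?D2 = ?v
        \<and> distr N M G = density M (\<lambda>x. ennreal (p_data x))
        \<and> (AE x in M. q x = p_data x)
        \<and> (AE x in M. ?D1 x = \<alpha> \<and> ?D2 x = \<beta>)
        \<and> (\<forall>x\<in>space M. q x = p_data x \<longrightarrow> ?D1 x = \<alpha> \<and> ?D2 x = \<beta>)"
      using eq D_eq opt_const induces_densityD(3)[OF G] by auto
  qed
qed

end
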